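(* Given any dual variable $\bm{\tau}=(\tau_i)_{i\in\mathcal V}$, $\tau_i\geqslant 0$, the pair $(\bm{\alpha}^{*},\bm{\beta}^{*})$ produced by the two-stage method described in the context is exactly the optimal solution to the inner problem $(\mathrm{I}_{\bm\tau})$.
   Context: Setting. $\mathcal V=\{1,\dots,V\}$ is a set of vehicle users (VUEs) and $\mathcal K=\{1,\dots,N\}$ a library of knowledge bases (KBs). Each VUE $i$ has the neighbor set $\mathcal V_i=\{j\in\mathcal V: j\neq i,\ \gamma_{i,j}\geqslant\gamma_0\}$, where $\gamma_{i,j}$ is the signal-to-interference-plus-noise ratio of the link between $i$ and $j$ and $\gamma_0$ is a threshold; $j\in\mathcal V_i$ if and only if $i\in\mathcal V_j$. Given parameters: KB storage sizes $s_n$; VUE storage capacities $C_i$; total packet arrival rates $\lambda_i$; mean interpretation times $1/\mu_i^n$ of KB $n$-based packets at VUE $i$; a threshold $\eta_0$; and Zipf preferences $p_i^n=(r_i^n)^{-\xi_i}/\sum_{e\in\mathcal K}e^{-\xi_i}$, where $\xi_i\geqslant 0$ and $r_i^n$ is the popularity rank of KB $n$ at VUE $i$. Put $\lambda_i^n=\lambda_i p_i^n$. Knowledge base construction (KBC) variables: $\alpha_i^n\in\{0,1\}$ ($\alpha_i^n=1$ if KB $n$ is constructed at VUE $i$), $\bm\alpha_i=(\alpha_i^n)_{n\in\mathcal K}$, $\bm\alpha=(\bm\alpha_i)_{i\in\mathcal V}$. Vehicle service pairing (VSP) variables: $\beta_{i\looparrowright j}\in\{0,1\}$ ($i\in\mathcal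 V$, $j\in\mathcal V_i$; equal to $1$ if sender $i$ is associated with receiver $j$), $\bm\beta=(\beta_{i\looparrowright j})$. Derived quantities, for $i\in\mathcal V$, $j\in\mathcal V_i$: - $\eta_i=\sum_{n\in\mathcal K}\alpha_i^n p_i^n$. - $\theta_{i\looparrowright j}=\dfrac{\sum_{n}\alpha_i^n(1-\alpha_j^n)\lambda_i^n}{\sum_n\alpha_i^n\lambda_i^n}$. - With $\lambda^{\mathit{eff}}_{i\looparrowright j}=\sum_n\alpha_i^n\alpha_j^n\lambda_i^n$, $\epsilon^n_{i\looparrowright j}=p_i^n/\sum_{f\in\mathcal K}\alpha_i^f\alpha_j^f p_i^f$, $E_{i\looparrowright j}=\sum_n\alpha_i^n\alpha_j^n\epsilon^n_{i\looparrowright j}/\mu_j^n$ and $S_{i\looparrowright j}=\sum_n\alpha_i^n\alpha_j^n(\epsilon^n_{i\looparrowright j}/\mu_j^n)^2$, the average queuing latency is $$\delta_{i\looparrowright j}=\frac{\lambda^{\mathit{eff}}_{i\looparrowright j}\,(E_{i\looparrowright j}^2+S_{i\looparrowright j})}{2(1-\lambda^{\mathit{eff}}_{i\looparrowright j}E_{i\looparrowright j})}.$$ It is assumed that $\lambda^{\mathit{eff}}_{i\looparrowright j}E_{i\looparrowright j}<1$ (steady state of the queue). Inner problem $(\mathrm{I}_{\bm\tau})$: minimize over $(\bm\alpha,\bm\beta)$ $$\widetilde L_{\bm\tau}(\bm\alpha,\bm\beta)=\sum_{i\in\mathcal V}\sum_{j\in\mathcal V_i}\beta_{i\looparrowright j}(\delta_{i\looparrowright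 j}+\tau_i\theta_{i\looparrowright j})$$ subject to $\sum_{n}\alpha_i^n s_n\leqslant C_i$ and $\eta_i\geqslant\eta_0$ for all $i\in\mathcal V$; $\sum_{j\in\mathcal V_i}\beta_{i\looparrowright j}=1$ for all $i\in\mathcal V$; $\beta_{i\looparrowright j}=\beta_{j\looparrowright i}$ for all $i\in\mathcal V$, $j\in\mathcal V_i$; all $\alpha_i^n,\beta_{i\looparrowright j}\in\{0,1\}$. Two-stage method, for given $\bm\tau$. Stage 1 (pair subproblem for each pair $i,j$ with $i\in\mathcal V$, $j\in\mathcal V_i$; one problem per unordered pair, since $\omega_{i,j}=\omega_{j,i}$): minimize over $\bm\alpha_i,\bm\alpha_j\in\{0,1\}^N$ $$\omega_{i,j}=(\delta_{i\looparrowright j}+\tau_i\theta_{i\looparrowright j})+(\delta_{j\looparrowright i}+\tau_j\theta_{j\looparrowright i})$$ subject to $\sum_n\alpha_i^n s_n\leqslant C_i$, $\sum_n\alpha_j^n s_n\leqslant C_j$, $\eta_i\geqslant\eta_0$, $\eta_j\geqslant\eta_0$. Solving it gives the optimal KBC sub-policies $\bm\alpha^*_{i_{(j)}}$ (for VUE $i$) and $\bm\alpha^*_{j_{(i)}}$ (for VUE $j$) and the optimal value $\omega^*_{i,j}=\omega^*_{j,i}$. Stage 2 (pairing problem): $\bm\beta^*$ is the optimal solution of: minimize over $\bm\beta$ the quantity $\frac12\sum_{i\in\mathcal V}\sum_{j\in\mathcal V_i}\beta_{i\looparrowright j}\,\omega^*_{i,j}$ subject to $\sum_{j\in\mathcal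 V_i}\beta_{i\looparrowright j}=1$ for all $i\in\mathcal V$, and $\beta_{i\looparrowright j}=\beta_{j\looparrowright i}$, $\beta_{i\looparrowright j}\in\{0,1\}$ for all $i\in\mathcal V$, $j\in\mathcal V_i$. For each $i$ let $j_i^*\in\mathcal V_i$ be the VUE paired with $i$ under $\bm\beta^*$, i.e. $\beta^*_{i\looparrowright j_i^*}=1$. Then $\bm\alpha^*=[\bm\alpha^*_1,\dots,\bm\alpha^*_V]^T$ is defined by $\bm\alpha^*_i=\bm\alpha^*_{i_{(j_i^* )}}$ for every $i\in\mathcal V$. *)

theory Defs
  imports Complex_Main
begin

record vehicular_network =
  num_vues :: nat
  num_kbs :: nat
  sinr :: "nat \<Rightarrow> nat \<Rightarrow> real"
  sinr_threshold :: real
  kb_size :: "nat \<Rightarrow> real"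
  capacity :: "nat \<Rightarrow> real"
  arrival_rate :: "nat \<Rightarrow> real"
  interp_rate :: "nat \<Rightarrow> nat \<Rightarrow> real"  \<comment> \<open>\<open>interp_rate M i n\<close> is \<open>\<mu>\<close>; the mean interpretation time is its reciprocal\<close>
  eta_threshold :: real
  zipf_exponent :: "nat \<Rightarrow> real"
  kb_rank :: "nat \<Rightarrow> nat \<Rightarrow> nat"

definition vues :: "vehicular_network \<Rightarrow> nat set" where
  "vues M = {1..num_vues M}"

definition kbs :: "vehicular_network \<Rightarrow> nat set" where
  "kbs M = {1..num_kbs M}"

definition neighbors :: "vehicular_network \<Rightarrow> nat \<Rightarrow> nat set" where
  "neighbors M i = {j \<in> vues M. j \<noteq> i \<and> sinr M i j \<ge> sinr_threshold M}"

definition pref :: "vehicular_network \<Rightarrow> nat \<Rightarrow> nat \<Rightarrow> real" where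
  "pref M i n = real (kb_rank M i n) powr (- zipf_exponent M i)
     / (\<Sum>e\<in>kbs M. real e powr (- zipf_exponent M i))"

definition kb_arrival_rate :: "vehicular_network \<Rightarrow> nat \<Rightarrow> nat \<Rightarrow> real" where
  "kb_arrival_rate M i n = arrival_rate M i * pref M i n"

text \<open>
  Below, \<open>a\<close> and \<open>b\<close> are the KBC sub-policies (functions of the KB index) of the sender \<open>i\<close> and of
  the receiver \<open>j\<close>, respectively, so the quantities of the reverse link are obtained by swapping
  both \<open>i\<close> with \<open>j\<close> and \<open>a\<close> with \<open>b\<close>.
  If the two VUEs share no KB, the value \<open>x / 0 = 0\<close> in \<open>kb_share\<close> is irrelevant: every occurrence
  is multiplied by \<open>a n * b n = 0\<close>, and the latency is \<open>0\<close>.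
\<close>

definition eta :: "vehicular_network \<Rightarrow> nat \<Rightarrow> (nat \<Rightarrow> real) \<Rightarrow> real" where
  "eta M i a = (\<Sum>n\<in>kbs M. a n * pref M i n)"

definition theta :: "vehicular_network \<Rightarrow> nat \<Rightarrow> (nat \<Rightarrow> real) \<Rightarrow> (nat \<Rightarrow> real) \<Rightarrow> real" where
  "theta M i a b = (\<Sum>n\<in>kbs M. a n * (1 - b n) * kb_arrival_rate M i n)
     / (\<Sum>n\<in>kbs M. a n * kb_arrival_rate M i n)"

definition eff_rate :: "vehicular_network \<Rightarrow> nat \<Rightarrow> (nat \<Rightarrow> real) \<Rightarrow> (nat \<Rightarrow> real) \<Rightarrow> real" where
  "eff_rate M i a b = (\<Sum>n\<in>kbs M. a n * b n * kb_arrival_rate M i n)"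

definition kb_share ::
  "vehicular_network \<Rightarrow> nat \<Rightarrow> (nat \<Rightarrow> real) \<Rightarrow> (nat \<Rightarrow> real) \<Rightarrow> nat \<Rightarrow> real" where
  "kb_share M i a b n = pref M i n / (\<Sum>f\<in>kbs M. a f * b f * pref M i f)"

definition mean_time ::
  "vehicular_network \<Rightarrow> nat \<Rightarrow> nat \<Rightarrow> (nat \<Rightarrow> real) \<Rightarrow> (nat \<Rightarrow> real) \<Rightarrow> real" where
  "mean_time M i j a b = (\<Sum>n\<in>kbs M. a n * b n * (kb_share M i a b n / interp_rate M j n))"

definition sq_time ::
  "vehicular_network \<Rightarrow> nat \<Rightarrow> nat \<Rightarrow> (nat \<Rightarrow> real) \<Rightarrow> (nat \<Rightarrow> real) \<Rightarrow> real" where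
  "sq_time M i j a b = (\<Sum>n\<in>kbs M. a n * b n * (kb_share M i a b n / interp_rate M j n)\<^sup>2)"

definition delta ::
  "vehicular_network \<Rightarrow> nat \<Rightarrow> nat \<Rightarrow> (nat \<Rightarrow> real) \<Rightarrow> (nat \<Rightarrow> real) \<Rightarrow> real" where
  "delta M i j a b =
     eff_rate M i a b * ((mean_time M i j a b)\<^sup>2 + sq_time M i j a b)
       / (2 * (1 - eff_rate M i a b * mean_time M i j a b))"

definition link_cost ::
  "vehicular_network \<Rightarrow> (nat \<Rightarrow> real) \<Rightarrow> nat \<Rightarrow> nat \<Rightarrow> (nat \<Rightarrow> real) \<Rightarrow> (nat \<Rightarrow> real) \<Rightarrow> real" where
  "link_cost M \<tau> i j a b = delta M i j a b + \<tau> i * theta M i a b"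

definition kbc_feasible :: "vehicular_network \<Rightarrow> nat \<Rightarrow> (nat \<Rightarrow> real) \<Rightarrow> bool" where
  "kbc_feasible M i a \<longleftrightarrow>
     (\<forall>n\<in>kbs M. a n \<in> {0, 1}) \<and>
     (\<Sum>n\<in>kbs M. a n * kb_size M n) \<le> capacity M i \<and>
     eta M i a \<ge> eta_threshold M"

definition vsp_feasible :: "vehicular_network \<Rightarrow> (nat \<Rightarrow> nat \<Rightarrow> real) \<Rightarrow> bool" where
  "vsp_feasible M \<beta> \<longleftrightarrow>
     (\<forall>i\<in>vues M. \<forall>j\<in>neighbors M i. \<beta> i j \<in> {0, 1}) \<and>
     (\<forall>i\<in>vues M. (\<Sum>j\<in>neighbors M i. \<beta> i j) = 1) \<and>
     (\<forall>i\<in>vues M. \<forall>j\<in>neighbors M i. \<beta> i j = \<beta> j i)"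

text \<open>The last condition is the steady state of the queues, for all admissible sub-policies.\<close>

definition valid_network :: "vehicular_network \<Rightarrow> bool" where
  "valid_network M \<longleftrightarrow>
     (\<forall>i\<in>vues M. \<forall>j\<in>vues M. j \<in> neighbors M i \<longleftrightarrow> i \<in> neighbors M j) \<and>
     (\<forall>i\<in>vues M. zipf_exponent M i \<ge> 0) \<and>
     (\<forall>i\<in>vues M. bij_betw (kb_rank M i) (kbs M) (kbs M)) \<and>
     (\<forall>i\<in>vues M. \<forall>j\<in>neighbors M i. \<forall>a b. kbc_feasible M i a \<longrightarrow> kbc_feasible M j b \<longrightarrow>
        eff_rate M i a b * mean_time M i j a b < 1)"

definition inner_objective ::
  "vehicular_network \<Rightarrow> (nat \<Rightarrow> real) \<Rightarrow> (nat \<Rightarrow> nat \<Rightarrow> real) \<Rightarrow> (nat \<Rightarrow> nat \<Rightarrow> real) \<Rightarrow> real" where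
  "inner_objective M \<tau> \<alpha> \<beta> =
     (\<Sum>i\<in>vues M. \<Sum>j\<in>neighbors M i. \<beta> i j * link_cost M \<tau> i j (\<alpha> i) (\<alpha> j))"

definition inner_feasible ::
  "vehicular_network \<Rightarrow> (nat \<Rightarrow> nat \<Rightarrow> real) \<Rightarrow> (nat \<Rightarrow> nat \<Rightarrow> real) \<Rightarrow> bool" where
  "inner_feasible M \<alpha> \<beta> \<longleftrightarrow> (\<forall>i\<in>vues M. kbc_feasible M i (\<alpha> i)) \<and> vsp_feasible M \<beta>"

definition inner_optimal ::
  "vehicular_network \<Rightarrow> (nat \<Rightarrow> real) \<Rightarrow> (nat \<Rightarrow> nat \<Rightarrow> real) \<Rightarrow> (nat \<Rightarrow> nat \<Rightarrow> real) \<Rightarrow> bool" where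
  "inner_optimal M \<tau> \<alpha> \<beta> \<longleftrightarrow>
     is_arg_min (\<lambda>(\<alpha>', \<beta>'). inner_objective M \<tau> \<alpha>' \<beta>')
       (\<lambda>(\<alpha>', \<beta>'). inner_feasible M \<alpha>' \<beta>') (\<alpha>, \<beta>)"

definition omega ::
  "vehicular_network \<Rightarrow> (nat \<Rightarrow> real) \<Rightarrow> nat \<Rightarrow> nat \<Rightarrow> (nat \<Rightarrow> real) \<Rightarrow> (nat \<Rightarrow> real) \<Rightarrow> real" where
  "omega M \<tau> i j a b = link_cost M \<tau> i j a b + link_cost M \<tau> j i b a"

definition pair_optimal ::
  "vehicular_network \<Rightarrow> (nat \<Rightarrow> real) \<Rightarrow> nat \<Rightarrow> nat \<Rightarrow> (nat \<Rightarrow> real) \<Rightarrow> (nat \<Rightarrow> real) \<Rightarrow> bool" where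
  "pair_optimal M \<tau> i j a b \<longleftrightarrow>
     is_arg_min (\<lambda>(a', b'). omega M \<tau> i j a' b')
       (\<lambda>(a', b'). kbc_feasible M i a' \<and> kbc_feasible M j b') (a, b)"

text \<open>
  \<open>A i j\<close> is the sub-policy of VUE \<open>i\<close> obtained from the subproblem of the pair \<open>i\<close>, \<open>j\<close>. Both
  orientations of a pair refer to the same solution \<open>(A i j, A j i)\<close>, i.e. one subproblem is solved
  per unordered pair, and ties between several minimizers are broken jointly for the two VUEs.
\<close>

definition stage1_solution ::
  "vehicular_network \<Rightarrow> (nat \<Rightarrow> real) \<Rightarrow> (nat \<Rightarrow> nat \<Rightarrow> nat \<Rightarrow> real) \<Rightarrow> bool" where
  "stage1_solution M \<tau> A \<longleftrightarrow>
     (\<forall>i\<in>vues M. \<forall>j\<in>neighbors M i. pair_optimal M \<tau> i j (A i j) (A j i))"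

definition pairing_objective ::
  "vehicular_network \<Rightarrow> (nat \<Rightarrow> nat \<Rightarrow> real) \<Rightarrow> (nat \<Rightarrow> nat \<Rightarrow> real) \<Rightarrow> real" where
  "pairing_objective M w \<beta> = 1 / 2 * (\<Sum>i\<in>vues M. \<Sum>j\<in>neighbors M i. \<beta> i j * w i j)"

definition stage2_solution ::
  "vehicular_network \<Rightarrow> (nat \<Rightarrow> nat \<Rightarrow> real) \<Rightarrow> (nat \<Rightarrow> nat \<Rightarrow> real) \<Rightarrow> bool" where
  "stage2_solution M w \<beta> \<longleftrightarrow> is_arg_min (pairing_objective M w) (vsp_feasible M) \<beta>"

definition partner :: "vehicular_network \<Rightarrow> (nat \<Rightarrow> nat \<Rightarrow> real) \<Rightarrow> nat \<Rightarrow> nat" where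
  "partner M \<beta> i = (THE j. j \<in> neighbors M i \<and> \<beta> i j = 1)"

text \<open>Minimizers need not be unique, so the two-stage method is a relation covering every choice.\<close>

definition two_stage_output ::
  "vehicular_network \<Rightarrow> (nat \<Rightarrow> real) \<Rightarrow> (nat \<Rightarrow> nat \<Rightarrow> real) \<Rightarrow> (nat \<Rightarrow> nat \<Rightarrow> real) \<Rightarrow> bool" where
  "two_stage_output M \<tau> \<alpha> \<beta> \<longleftrightarrow>
     (\<exists>A. stage1_solution M \<tau> A \<and>
          stage2_solution M (\<lambda>i j. omega M \<tau> i j (A i j) (A j i)) \<beta> \<and>
          (\<forall>i\<in>vues M. \<alpha> i = A i (partner M \<beta> i)))"

end

theory Submission
  imports Defs
begin

text \<open>
  A feasible \<open>\<beta>\<close> is symmetric, so the inner objective is the pairing objective whose weights are the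
  values \<open>\<omega>\<close> attained by the given sub-policies. Those weights are bounded below by the stage 1
  optima, and stage 2 minimizes the pairing objective with the optima as weights. The stage 1
  optima are attained simultaneously by the assembled \<open>\<alpha>\<close>: each VUE occurs in exactly one pair of
  \<open>\<beta>\<close>, so the sub-policies of different pairs never conflict.
\<close>

lemma finite_neighbors [simp]: "finite (neighbors M i)"
  by (simp add: neighbors_def vues_def)

lemma neighbors_sym:
  assumes "valid_network M" "i \<in> vues M" "j \<in> neighbors M i"
  shows "j \<in> vues M" "i \<in> neighbors M j"
  using assms by (auto simp: valid_network_def neighbors_def)

text \<open>By symmetry of the neighbor relation the double sum runs over a set of ordered pairs
  closed under reversal. This is what lets a link cost be traded for the cost of the reverse
  link.\<close>

lemma sum_neighbors_swap:
  fixes f :: "nat \<Rightarrow> nat \<Rightarrow> real"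
  assumes "valid_network M"
  shows "(\<Sum>i\<in>vues M. \<Sum>j\<in>neighbors M i. f i j) = (\<Sum>i\<in>vues M. \<Sum>j\<in>neighbors M i. f j i)"
proof -
  \<comment> \<open>The inner index set has to appear as a restriction of \<open>vues M\<close> for
    \<open>sum.swap_restrict\<close> to apply.\<close>
  have *: "neighbors M i = {j \<in> vues M. j \<in> neighbors M i}" for i
    by (auto simp: neighbors_def)
  have "(\<Sum>i\<in>vues M. \<Sum>j\<in>neighbors M i. f i j)
      = (\<Sum>i\<in>vues M. \<Sum>j | j \<in> vues M \<and> j \<in> neighbors M i. f i j)"
    using * by simp
  also have "\<dots> = (\<Sum>j\<in>vues M. \<Sum>i | i \<in> vues M \<and> j \<in> neighbors M i. f i j)"
    by (rule sum.swap_restrict) (simp_all add: vues_def)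
  also have "\<dots> = (\<Sum>j\<in>vues M. \<Sum>i\<in>neighbors M j. f i j)"
  proof (rule sum.cong[OF refl])
    fix j assume "j \<in> vues M"
    then have "{i \<in> vues M. j \<in> neighbors M i} = neighbors M j"
      using neighbors_sym[OF assms] by blast
    then show "(\<Sum>i | i \<in> vues M \<and> j \<in> neighbors M i. f i j) = (\<Sum>i\<in>neighbors M j. f i j)"
      by simp
  qed
  finally show ?thesis .
qed

lemma vsp_feasibleD:
  assumes "vsp_feasible M \<beta>" "i \<in> vues M"
  shows "(\<Sum>j\<in>neighbors M i. \<beta> i j) = 1"
    and "j \<in> neighbors M i \<Longrightarrow> \<beta> i j = 0 \<or> \<beta> i j = 1"
    and "j \<in> neighbors M i \<Longrightarrow> \<beta> j i = \<beta> i j"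
  using assms unfolding vsp_feasible_def by fastforce+

text \<open>Adding the objective to its reversed form puts both link costs, that is
  \<open>omega\<close>, on every ordered pair; the factor 1/2 undoes the doubling.\<close>

lemma inner_objective_eq_pairing_objective:
  assumes "valid_network M" "vsp_feasible M \<beta>"
  shows "inner_objective M \<tau> \<alpha> \<beta> = pairing_objective M (\<lambda>i j. omega M \<tau> i j (\<alpha> i) (\<alpha> j)) \<beta>"
proof -
  let ?c = "\<lambda>i j. link_cost M \<tau> i j (\<alpha> i) (\<alpha> j)"
  have "inner_objective M \<tau> \<alpha> \<beta> = (\<Sum>i\<in>vues M. \<Sum>j\<in>neighbors M i. \<beta> j i * ?c j i)"
    unfolding inner_objective_def by (rule sum_neighbors_swap[OF assms(1)])
  also have "\<dots> = (\<Sum>i\<in>vues M. \<Sum>j\<in>neighbors M i. \<beta> i j * ?c j i)"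
    using vsp_feasibleD(3)[OF assms(2)] by (intro sum.cong refl) simp
  finally have "2 * inner_objective M \<tau> \<alpha> \<beta>
      = (\<Sum>i\<in>vues M. \<Sum>j\<in>neighbors M i. \<beta> i j * ?c i j)
        + (\<Sum>i\<in>vues M. \<Sum>j\<in>neighbors M i. \<beta> i j * ?c j i)"
    by (simp add: inner_objective_def)
  then show ?thesis
    by (simp add: pairing_objective_def omega_def distrib_left sum.distrib)
qed

text \<open>Values in {0, 1} with sum 1 contain exactly one 1. This makes the definite description
  in \<open>partner\<close> meaningful.\<close>

lemma vsp_feasible_unique:
  assumes "vsp_feasible M \<beta>" "i \<in> vues M"
  shows "\<exists>!j. j \<in> neighbors M i \<and> \<beta> i j = 1"
proof -
  have bin: "\<beta> i j = 0 \<or> \<beta> i j = 1" if "j \<in> neighbors M i" for j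
    using vsp_feasibleD(2)[OF assms that] .
  note sum1 = vsp_feasibleD(1)[OF assms]
  obtain j where j: "j \<in> neighbors M i" "\<beta> i j = 1"
    using sum1 bin by (metis sum.neutral zero_neq_one)
  \<comment> \<open>The chosen \<open>j\<close> already uses up the total 1, so the remaining
    nonnegative terms all vanish.\<close>
  have "(\<Sum>k\<in>neighbors M i - {j}. \<beta> i k) = 0"
    using sum1 j by (simp add: sum_diff1)
  then have "\<forall>k\<in>neighbors M i - {j}. \<beta> i k = 0"
    using bin by (subst (asm) sum_nonneg_eq_0_iff) force+
  then have "k = j" if "k \<in> neighbors M i" "\<beta> i k = 1" for k
    using that by force
  with j show ?thesis by blast
qed

lemma partner_mem:
  assumes "vsp_feasible M \<beta>" "i \<in> vues M"
  shows "partner M \<beta> i \<in> neighbors M i"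
  using theI'[OF vsp_feasible_unique[OF assms]] by (simp add: partner_def)

lemma partner_eqI:
  assumes "vsp_feasible M \<beta>" "i \<in> vues M" "j \<in> neighbors M i" "\<beta> i j = 1"
  shows "partner M \<beta> i = j"
  unfolding partner_def
  using the1_equality[OF vsp_feasible_unique[OF assms(1,2)]] assms(3,4) by blast

text \<open>Weights are compared only on selected pairs, since the others contribute 0. The
  restriction matters because the assembled policy matches the stage 1 solutions only there.\<close>

lemma pairing_objective_mono:
  assumes "vsp_feasible M \<beta>"
    and "\<And>i j. i \<in> vues M \<Longrightarrow> j \<in> neighbors M i \<Longrightarrow> \<beta> i j = 1 \<Longrightarrow> w i j \<le> w' i j"
  shows "pairing_objective M w \<beta> \<le> pairing_objective M w' \<beta>"
proof -
  have "\<beta> i j * w i j \<le> \<beta> i j * w' i j" if "i \<in> vues M" "j \<in> neighbors M i" for i j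
  proof -
    have "\<beta> i j = 0 \<or> \<beta> i j = 1"
      using vsp_feasibleD(2)[OF assms(1) that] .
    then show ?thesis using assms(2)[OF that] by auto
  qed
  then show ?thesis
    by (simp add: pairing_objective_def sum_mono)
qed

theorem proposition2:
  fixes M :: vehicular_network
    and \<tau> :: "nat \<Rightarrow> real"
    and \<alpha>_opt \<beta>_opt :: "nat \<Rightarrow> nat \<Rightarrow> real"
  assumes "valid_network M"
    and "\<forall>i\<in>vues M. \<tau> i \<ge> 0"
    and "two_stage_output M \<tau> \<alpha>_opt \<beta>_opt"
  shows "inner_optimal M \<tau> \<alpha>_opt \<beta>_opt"
proof -
  obtain A where s1: "stage1_solution M \<tau> A"
    and s2: "stage2_solution M (\<lambda>i j. omega M \<tau> i j (A i j) (A j i)) \<beta>_opt"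
    and \<alpha>: "\<And>i. i \<in> vues M \<Longrightarrow> \<alpha>_opt i = A i (partner M \<beta>_opt i)"
    using assms(3) unfolding two_stage_output_def by blast
  let ?w = "\<lambda>i j. omega M \<tau> i j (A i j) (A j i)"
  have feas\<beta>: "vsp_feasible M \<beta>_opt"
    and opt\<beta>: "\<And>\<beta>. vsp_feasible M \<beta> \<Longrightarrow> pairing_objective M ?w \<beta>_opt \<le> pairing_objective M ?w \<beta>"
    using s2 by (auto simp: stage2_solution_def is_arg_min_linorder)
  have pair: "kbc_feasible M i (A i j)"
    "\<And>a b. kbc_feasible M i a \<Longrightarrow> kbc_feasible M j b \<Longrightarrow> ?w i j \<le> omega M \<tau> i j a b"
    if "i \<in> vues M" "j \<in> neighbors M i" for i j
    using s1 that by (auto simp: stage1_solution_def pair_optimal_def is_arg_min_linorder)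
  have feas: "inner_feasible M \<alpha>_opt \<beta>_opt"
    using feas\<beta> \<alpha> pair(1) partner_mem by (simp add: inner_feasible_def)
  have "inner_objective M \<tau> \<alpha>_opt \<beta>_opt \<le> inner_objective M \<tau> \<alpha> \<beta>"
    if "inner_feasible M \<alpha> \<beta>" for \<alpha> \<beta>
  proof -
    have f: "vsp_feasible M \<beta>" "\<And>i. i \<in> vues M \<Longrightarrow> kbc_feasible M i (\<alpha> i)"
      using that by (auto simp: inner_feasible_def)
    have "inner_objective M \<tau> \<alpha>_opt \<beta>_opt
        = pairing_objective M (\<lambda>i j. omega M \<tau> i j (\<alpha>_opt i) (\<alpha>_opt j)) \<beta>_opt"
      by (rule inner_objective_eq_pairing_objective[OF assms(1) feas\<beta>])
    also have "\<dots> \<le> pairing_objective M ?w \<beta>_opt"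
    proof (rule pairing_objective_mono[OF feas\<beta>])
      fix i j assume ij: "i \<in> vues M" "j \<in> neighbors M i" "\<beta>_opt i j = 1"
      note ji = neighbors_sym[OF assms(1) ij(1,2)]
      \<comment> \<open>Partnership is mutual, so both ends take their sub-policies from one and the
        same solution \<open>(A i j, A j i)\<close>.\<close>
      have "\<beta>_opt j i = 1"
        using vsp_feasibleD(3)[OF feas\<beta> ij(1,2)] ij(3) by simp
      then have "\<alpha>_opt i = A i j" "\<alpha>_opt j = A j i"
        using ij ji \<alpha> partner_eqI[OF feas\<beta>] by simp_all
      then show "omega M \<tau> i j (\<alpha>_opt i) (\<alpha>_opt j) \<le> ?w i j" by simp
    qed
    also have "\<dots> \<le> pairing_objective M ?w \<beta>"
      by (rule opt\<beta>[OF f(1)])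
    \<comment> \<open>The constraints on \<alpha> are separate for each VUE, so its values at
      \<open>i\<close> and \<open>j\<close> compete in the pair subproblem.\<close>
    also have "\<dots> \<le> pairing_objective M (\<lambda>i j. omega M \<tau> i j (\<alpha> i) (\<alpha> j)) \<beta>"
      using pairing_objective_mono[OF f(1)] pair(2) f(2) neighbors_sym(1)[OF assms(1)] by simp
    also have "\<dots> = inner_objective M \<tau> \<alpha> \<beta>"
      by (rule inner_objective_eq_pairing_objective[OF assms(1) f(1), symmetric])
    finally show ?thesis .
  qed
  with feas show ?thesis
    by (auto simp: inner_optimal_def is_arg_min_linorder)
qed

end
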